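(* Let $G$ be a finite connected simple graph with vertex set $V(G)=\{1,\dots,n\}$, let $\mathrm{k}$ be a field, $S=\mathrm{k}[x_1,\dots,x_n]$, $\mathfrak m=(x_1,\dots,x_n)$, and let $NI(G)\subseteq S$ be the closed neighborhood ideal of $G$. Assume that $\mathfrak m$ is an associated prime of $S/NI(G)^2$. Then $\mathrm{diam}(G)\le 6$.
   Context: For a vertex $i$ of $G$, $N_G(i)=\{j : \{i,j\}\in E(G)\}$ and $N_G[i]=N_G(i)\cup\{i\}$. For $W\subseteq\{1,\dots,n\}$, $x_W=\prod_{j\in W}x_j$. The closed neighborhood ideal of $G$ is $NI(G)=(x_{N_G[i]} \mid i=1,\dots,n)\subseteq S$. The diameter $\mathrm{diam}(G)$ is the maximum over pairs of vertices of the length of a shortest path connecting them. A prime ideal $P$ of a Noetherian ring $R$ is an associated prime of an $R$-module $M$ if $P=\mathrm{Ann}(y)$ for some $y\in M$. *)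

theory Defs
  imports
    "Graph_Theory.Graph_Theory"
    "HOL-Library.Poly_Mapping"
    "HOL-Algebra.Ideal_Product"
    "HOL-Algebra.QuotRing"
    "HOL-Algebra.Module"
begin

section \<open>Graphs\<close>

text \<open>A finite simple graph is a \<^locale>\<open>pair_graph\<close>: a finite loop-free digraph whose arcs are
  pairs of vertices and form a symmetric relation, so that the edge \<open>{i, j}\<close> corresponds to the two
  arcs \<open>(i, j)\<close> and \<open>(j, i)\<close>.\<close>

definition nbhd :: "'a pair_pre_digraph \<Rightarrow> 'a \<Rightarrow> 'a set" where
  "nbhd G i = {j. (i, j) \<in> parcs G}"

definition closed_nbhd :: "'a pair_pre_digraph \<Rightarrow> 'a \<Rightarrow> 'a set" where
  "closed_nbhd G i = nbhd G i \<union> {i}"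

text \<open>With all arc weights equal to one, \<open>wf_digraph.\<mu>\<close> is the length of a shortest walk, hence of a
  shortest path (and \<open>\<infinity>\<close> if there is none).\<close>

definition graph_dist :: "'a pair_pre_digraph \<Rightarrow> 'a \<Rightarrow> 'a \<Rightarrow> ereal" where
  "graph_dist G u v = wf_digraph.\<mu> (with_proj G) (\<lambda>_. 1) u v"

definition graph_diam :: "'a pair_pre_digraph \<Rightarrow> ereal" where
  "graph_diam G = Max {graph_dist G u v | u v. u \<in> pverts G \<and> v \<in> pverts G}"

section \<open>Associated primes\<close>

definition annihilator :: "('a, 'r) ring_scheme \<Rightarrow> ('a, 'b, 'm) module_scheme \<Rightarrow> 'b \<Rightarrow> 'a set" where
  "annihilator R M y = {r \<in> carrier R. r \<odot>\<^bsub>M\<^esub> y = \<zero>\<^bsub>M\<^esub>}"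

definition associated_prime ::
    "('a, 'r) ring_scheme \<Rightarrow> ('a, 'b, 'm) module_scheme \<Rightarrow> 'a set \<Rightarrow> bool" where
  "associated_prime R M P \<longleftrightarrow> primeideal P R \<and> (\<exists>y \<in> carrier M. P = annihilator R M y)"

text \<open>The quotient ring \<open>R / I\<close> as an \<open>R\<close>-module.\<close>

definition quot_module :: "('a, 'r) ring_scheme \<Rightarrow> 'a set \<Rightarrow> ('a, 'a set) module" where
  "quot_module R I =
     \<lparr>carrier = carrier (R Quot I), mult = mult (R Quot I), one = one (R Quot I),
      zero = zero (R Quot I), add = add (R Quot I),
      smult = (\<lambda>r X. (I +>\<^bsub>R\<^esub> r) \<otimes>\<^bsub>R Quot I\<^esub> X)\<rparr>"

lemma quot_module_is_module:
  assumes "cring R" and "ideal I R"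
  shows "Module.module R (quot_module R I)"
proof -
  interpret R: cring R by fact
  interpret I: ideal I R by fact
  interpret Q: cring "R Quot I" by (rule I.quotient_is_cring[OF assms(1)])
  interpret h: ring_hom_ring R "R Quot I" "(+>\<^bsub>R\<^esub>) I" by (rule I.rcos_ring_hom_ring)
  have add: "a \<oplus>\<^bsub>quot_module R I\<^esub> b = a \<oplus>\<^bsub>R Quot I\<^esub> b"
    and zero: "\<zero>\<^bsub>quot_module R I\<^esub> = \<zero>\<^bsub>R Quot I\<^esub>"
    and carr: "carrier (quot_module R I) = carrier (R Quot I)"
    and sm: "r \<odot>\<^bsub>quot_module R I\<^esub> a = (I +>\<^bsub>R\<^esub> r) \<otimes>\<^bsub>R Quot I\<^esub> a" for r a b
    by (simp_all add: quot_module_def)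
  have ag: "abelian_group (quot_module R I)"
  proof (rule abelian_groupI)
    fix x assume "x \<in> carrier (quot_module R I)"
    then show "\<exists>y \<in> carrier (quot_module R I).
        y \<oplus>\<^bsub>quot_module R I\<^esub> x = \<zero>\<^bsub>quot_module R I\<^esub>"
      unfolding add zero carr using Q.l_neg Q.a_inv_closed by blast
  next
    fix x y assume "x \<in> carrier (quot_module R I)" "y \<in> carrier (quot_module R I)"
    then show "x \<oplus>\<^bsub>quot_module R I\<^esub> y = y \<oplus>\<^bsub>quot_module R I\<^esub> x"
      unfolding add carr by (rule Q.a_comm)
  qed (simp_all add: add zero carr Q.a_assoc)
  show ?thesis
  proof (rule moduleI)
    fix a b x assume "a \<in> carrier R" "b \<in> carrier R" "x \<in> carrier (quot_module R I)"
    then show "(a \<otimes>\<^bsub>R\<^esub> b) \<odot>\<^bsub>quot_module R I\<^esub> x =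
        a \<odot>\<^bsub>quot_module R I\<^esub> (b \<odot>\<^bsub>quot_module R I\<^esub> x)"
      using h.hom_mult Q.m_assoc h.hom_closed unfolding carr sm by metis
  next
    fix a b x assume "a \<in> carrier R" "b \<in> carrier R" "x \<in> carrier (quot_module R I)"
    then show "(a \<oplus>\<^bsub>R\<^esub> b) \<odot>\<^bsub>quot_module R I\<^esub> x =
        a \<odot>\<^bsub>quot_module R I\<^esub> x \<oplus>\<^bsub>quot_module R I\<^esub> b \<odot>\<^bsub>quot_module R I\<^esub> x"
      using h.hom_add Q.l_distr h.hom_closed unfolding carr sm add by metis
  next
    fix x assume "x \<in> carrier (quot_module R I)"
    then show "\<one>\<^bsub>R\<^esub> \<odot>\<^bsub>quot_module R I\<^esub> x = x"
      using h.hom_one Q.l_one unfolding carr sm by metis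
  qed (use assms(1) ag in \<open>simp_all add: carr sm add Q.r_distr\<close>)
qed

section \<open>The polynomial ring and the closed neighborhood ideal\<close>

text \<open>Polynomials are finitely supported maps from exponent vectors to coefficients;
  \<open>poly_ring n\<close> consists of those in which only the variables \<open>x\<^sub>1, \<dots>, x\<^sub>n\<close> occur.\<close>

type_synonym 'k mpoly = "(nat \<Rightarrow>\<^sub>0 nat) \<Rightarrow>\<^sub>0 'k"

definition poly_ring :: "nat \<Rightarrow> 'k::field mpoly ring" where
  "poly_ring n =
     \<lparr>carrier = {p. \<forall>m \<in> Poly_Mapping.keys p. Poly_Mapping.keys m \<subseteq> {1..n}},
      mult = (*), one = 1, zero = 0, add = (+)\<rparr>"

lemma cring_poly_ring: "cring (poly_ring n :: 'k::field mpoly ring)"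
proof (rule cringI)
  show "abelian_group (poly_ring n :: 'k mpoly ring)"
  proof (rule abelian_groupI)
    fix p :: "'k mpoly" assume "p \<in> carrier (poly_ring n)"
    then show "\<exists>q \<in> carrier (poly_ring n). q \<oplus>\<^bsub>poly_ring n\<^esub> p = \<zero>\<^bsub>poly_ring n\<^esub>"
      by (intro bexI[of _ "- p"]) (auto simp: poly_ring_def)
  next
    fix p q :: "'k mpoly" assume "p \<in> carrier (poly_ring n)" "q \<in> carrier (poly_ring n)"
    then show "p \<oplus>\<^bsub>poly_ring n\<^esub> q \<in> carrier (poly_ring n)"
      using Poly_Mapping.keys_add[of p q] by (auto simp: poly_ring_def)
  qed (auto simp: poly_ring_def algebra_simps)
  show "Group.comm_monoid (poly_ring n :: 'k mpoly ring)"
  proof (rule comm_monoidI)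
    fix p q :: "'k mpoly" assume *: "p \<in> carrier (poly_ring n)" "q \<in> carrier (poly_ring n)"
    have "Poly_Mapping.keys m \<subseteq> {1..n}" if "m \<in> Poly_Mapping.keys (p * q)" for m
    proof -
      from that obtain a b where "a \<in> Poly_Mapping.keys p" "b \<in> Poly_Mapping.keys q" "m = a + b"
        using keys_mult[of p q] by blast
      then show ?thesis
        using * Poly_Mapping.keys_add[of a b] by (fastforce simp: poly_ring_def)
    qed
    then show "p \<otimes>\<^bsub>poly_ring n\<^esub> q \<in> carrier (poly_ring n)"
      by (simp add: poly_ring_def)
  qed (auto simp: poly_ring_def algebra_simps)
qed (auto simp: poly_ring_def algebra_simps)

definition var :: "nat \<Rightarrow> 'k::field mpoly" where
  "var i = Poly_Mapping.single (Poly_Mapping.single i 1) 1"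

definition var_prod :: "nat set \<Rightarrow> 'k::field mpoly" where
  "var_prod W = (\<Prod>j\<in>W. var j)"

definition irrelevant_ideal :: "nat \<Rightarrow> 'k::field mpoly set" where
  "irrelevant_ideal n = Idl\<^bsub>poly_ring n\<^esub> (var ` {1..n})"

definition closed_nbhd_ideal :: "nat \<Rightarrow> nat pair_pre_digraph \<Rightarrow> 'k::field mpoly set" where
  "closed_nbhd_ideal n G = Idl\<^bsub>poly_ring n\<^esub> ((\<lambda>i. var_prod (closed_nbhd G i)) ` {1..n})"

end

theory Submission
  imports Defs
begin

text \<open>Write \<open>I = NI(G)\<close>. Since \<open>I\<^sup>2\<close> is generated by monomials, membership in \<open>I\<^sup>2\<close> is decided term
  by term (\<open>mem_square_iff\<close>). So if the maximal ideal is the annihilator of the class of a polynomial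
  \<open>f\<close>, some term of \<open>f\<close> has a monomial \<open>u \<notin> I\<^sup>2\<close> with \<open>x\<^sub>i u \<in> I\<^sup>2\<close> for all \<open>i\<close>
  (\<open>socle_monomial\<close>).

  As the generators of \<open>I\<close> are squarefree, comparing exponents shows that \<open>u = x\<^sub>W\<close> is squarefree,
  and it turns the two properties of \<open>u\<close> into statements about which closed neighborhoods lie in
  \<open>W\<close> (\<open>socle_support\<close>). Let \<open>C\<close> be the set of vertices \<open>c\<close> with \<open>N[c] \<subseteq> W\<close>. From
  \<open>u \<notin> I\<^sup>2\<close>, the closed neighborhoods of any two vertices of \<open>C\<close> meet, so \<open>C\<close> has diameter at
  most \<open>2\<close> in \<open>G\<close>. From \<open>x\<^sub>i u \<in> I\<^sup>2\<close>, a vertex \<open>i\<close> is at distance at most \<open>1\<close> from \<open>C\<close> if it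
  lies in \<open>W\<close>, and it is equal or adjacent to a vertex of \<open>W\<close> otherwise. So any two vertices are
  joined by a walk of length at most \<open>2 + 2 + 2\<close> through \<open>C\<close> (\<open>graph_diam_le_6\<close>).\<close>

section \<open>Annihilators in quotient modules\<close>

lemma annihilator_quot_module:
  fixes R (structure)
  assumes "cring R" and "ideal I R" and f: "f \<in> carrier R"
  shows "annihilator R (quot_module R I) (I +> f) = {r \<in> carrier R. r \<otimes> f \<in> I}"
proof -
  interpret R: cring R by fact
  interpret I: ideal I R by fact
  have "(I +> r) \<otimes>\<^bsub>R Quot I\<^esub> (I +> f) = I \<longleftrightarrow> r \<otimes> f \<in> I" if r: "r \<in> carrier R" for r
  proof -
    have "(I +> r) \<otimes>\<^bsub>R Quot I\<^esub> (I +> f) = I +> (r \<otimes> f)"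
      using ring_hom_mult[OF I.rcos_ring_hom r f] by simp
    then show ?thesis
      using r f I.a_rcos_self I.a_rcos_const by (metis R.m_closed)
  qed
  then show ?thesis
    by (auto simp: annihilator_def quot_module_def FactRing_def)
qed

section \<open>Monomials in ideals generated by monomials\<close>

abbreviation monom :: "(nat \<Rightarrow>\<^sub>0 nat) \<Rightarrow> 'k::field \<Rightarrow> 'k mpoly" where
  "monom \<equiv> Poly_Mapping.single"

lemma lookup_single_times:
  fixes p :: "'a::cancel_comm_monoid_add \<Rightarrow>\<^sub>0 'b::semiring_0"
  shows "Poly_Mapping.lookup (Poly_Mapping.single s c * p) (s + m) = c * Poly_Mapping.lookup p m"
  by (simp add: lookup_mult lookup_single when_mult)

definition monomial_ideal :: "nat \<Rightarrow> (nat \<Rightarrow>\<^sub>0 nat) set \<Rightarrow> 'k::field mpoly set" where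
  "monomial_ideal n A =
     {p \<in> carrier (poly_ring n). \<forall>m \<in> Poly_Mapping.keys p. \<exists>a\<in>A. \<exists>t. m = a + t}"

lemma ideal_monomial_ideal: "ideal (monomial_ideal n A) (poly_ring n :: 'k::field mpoly ring)"
proof -
  interpret R: cring "poly_ring n :: 'k mpoly ring" by (rule cring_poly_ring)
  have inv: "\<ominus>\<^bsub>poly_ring n\<^esub> p = - p" if "p \<in> carrier (poly_ring n)" for p :: "'k mpoly"
    using that by (intro R.minus_equality) (auto simp: poly_ring_def)
  have mult: "q * p \<in> monomial_ideal n A"
    if p: "p \<in> monomial_ideal n A" and q: "q \<in> carrier (poly_ring n)" for p q :: "'k mpoly"
  proof -
    have "q * p \<in> carrier (poly_ring n)"
      using R.m_closed[of q p] p q by (simp add: monomial_ideal_def poly_ring_def)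
    moreover have "\<exists>a\<in>A. \<exists>t. m = a + t" if m: "m \<in> Poly_Mapping.keys (q * p)" for m
    proof -
      obtain r s where "m = r + s" "s \<in> Poly_Mapping.keys p"
        using m keys_mult[of q p] by blast
      moreover then obtain a t where "a \<in> A" "s = a + t"
        using p by (auto simp: monomial_ideal_def)
      ultimately have "m = a + (r + t)" by (simp add: ac_simps)
      then show ?thesis using \<open>a \<in> A\<close> by blast
    qed
    ultimately show ?thesis by (simp add: monomial_ideal_def)
  qed
  show ?thesis
  proof (rule idealI[OF R.ring_axioms])
    show "subgroup (monomial_ideal n A) (add_monoid (poly_ring n :: 'k mpoly ring))"
    proof (rule R.add.subgroupI)
      show "monomial_ideal n A \<subseteq> carrier (poly_ring n :: 'k mpoly ring)"
        by (auto simp: monomial_ideal_def)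
      have "0 \<in> monomial_ideal n A" by (simp add: monomial_ideal_def poly_ring_def)
      then show "monomial_ideal n A \<noteq> ({} :: 'k mpoly set)" by blast
    next
      fix p :: "'k mpoly" assume p: "p \<in> monomial_ideal n A"
      then have "\<ominus>\<^bsub>poly_ring n\<^esub> p = - p"
        by (intro inv) (simp add: monomial_ideal_def)
      with p show "\<ominus>\<^bsub>poly_ring n\<^esub> p \<in> monomial_ideal n A"
        by (simp add: monomial_ideal_def poly_ring_def)
    next
      fix p q :: "'k mpoly"
      assume "p \<in> monomial_ideal n A" "q \<in> monomial_ideal n A"
      then show "p \<oplus>\<^bsub>poly_ring n\<^esub> q \<in> monomial_ideal n A"
        using Poly_Mapping.keys_add[of p q]
        by (fastforce simp: monomial_ideal_def poly_ring_def)
    qed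
  next
    fix p q :: "'k mpoly"
    assume "p \<in> monomial_ideal n A" "q \<in> carrier (poly_ring n)"
    then have "q * p \<in> monomial_ideal n A" by (rule mult)
    then show "q \<otimes>\<^bsub>poly_ring n\<^esub> p \<in> monomial_ideal n A"
      "p \<otimes>\<^bsub>poly_ring n\<^esub> q \<in> monomial_ideal n A"
      by (simp_all add: poly_ring_def mult.commute)
  qed
qed

lemma genideal_subset_monomial_ideal:
  assumes "\<forall>a\<in>A. Poly_Mapping.keys a \<subseteq> {1..n}"
  shows "Idl\<^bsub>poly_ring n\<^esub> ((\<lambda>a. monom a (1::'k::field)) ` A) \<subseteq> monomial_ideal n A"
proof (rule ring.genideal_minimal)
  show "ring (poly_ring n :: 'k mpoly ring)" using cring_poly_ring by (rule cring.axioms)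
  have "\<exists>b\<in>A. \<exists>t. a = b + t" if "a \<in> A" for a
    using that by (metis add_0_right)
  then show "(\<lambda>a. monom a (1::'k)) ` A \<subseteq> monomial_ideal n A"
    using assms by (auto simp: monomial_ideal_def poly_ring_def)
qed (rule ideal_monomial_ideal)

text \<open>Every polynomial is the sum of its terms, so an ideal that contains all terms of a polynomial
  contains the polynomial.\<close>

lemma ideal_memI_terms:
  fixes p :: "'k::field mpoly"
  assumes "ideal J (poly_ring n)"
    and "\<And>m c. m \<in> Poly_Mapping.keys p \<Longrightarrow> monom m c \<in> J"
  shows "p \<in> J"
proof -
  interpret J: ideal J "poly_ring n :: 'k mpoly ring" by fact
  have "(\<Sum>m\<in>M. monom m (Poly_Mapping.lookup p m)) \<in> J" if "finite M" "M \<subseteq> Poly_Mapping.keys p" for M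
    using that
  proof (induction M rule: finite_induct)
    case empty
    have "\<zero>\<^bsub>poly_ring n\<^esub> \<in> J" by simp
    then show ?case by (simp add: poly_ring_def)
  next
    case (insert m M)
    then show ?case
      using additive_subgroup.a_closed[OF J.is_additive_subgroup,
          of "monom m (Poly_Mapping.lookup p m)" "\<Sum>m\<in>M. monom m (Poly_Mapping.lookup p m)"]
        assms(2)[of m]
      by (simp add: poly_ring_def del: One_nat_def)
  qed
  moreover have "(\<Sum>m\<in>Poly_Mapping.keys p. monom m (Poly_Mapping.lookup p m)) = p"
  proof (rule poly_mapping_eqI)
    fix k
    have "Poly_Mapping.lookup (\<Sum>m\<in>Poly_Mapping.keys p. monom m (Poly_Mapping.lookup p m)) k
        = (\<Sum>m\<in>Poly_Mapping.keys p. if m = k then Poly_Mapping.lookup p m else 0)"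
      by (simp add: lookup_sum lookup_single when_def)
    also have "\<dots> = Poly_Mapping.lookup p k"
      by (simp add: in_keys_iff)
    finally show "Poly_Mapping.lookup (\<Sum>m\<in>Poly_Mapping.keys p. monom m (Poly_Mapping.lookup p m)) k
      = Poly_Mapping.lookup p k" .
  qed
  ultimately show ?thesis by (metis finite_keys order_refl)
qed

text \<open>The terms of a product are products of terms, so every term of an element of \<open>I\<^sup>2\<close> is
  divisible by a product of two generators; conversely each such term lies in \<open>I\<^sup>2\<close>.\<close>

lemma mem_square_iff:
  fixes p :: "'k::field mpoly" and A :: "(nat \<Rightarrow>\<^sub>0 nat) set" and n :: nat
  defines "I \<equiv> Idl\<^bsub>poly_ring n\<^esub> ((\<lambda>a. monom a (1::'k)) ` A)"
  assumes A: "\<forall>a\<in>A. Poly_Mapping.keys a \<subseteq> {1..n}" and p: "p \<in> carrier (poly_ring n)"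
  shows "p \<in> I \<cdot>\<^bsub>poly_ring n\<^esub> I \<longleftrightarrow>
    (\<forall>m \<in> Poly_Mapping.keys p. \<exists>a\<in>A. \<exists>b\<in>A. \<exists>t. m = a + b + t)"
proof -
  interpret R: cring "poly_ring n :: 'k mpoly ring" by (rule cring_poly_ring)
  have gens: "(\<lambda>a. monom a (1::'k)) ` A \<subseteq> carrier (poly_ring n)"
    using A by (auto simp: poly_ring_def)
  interpret I: ideal I "poly_ring n :: 'k mpoly ring"
    unfolding I_def by (rule R.genideal_ideal[OF gens])
  have II: "ideal (I \<cdot>\<^bsub>poly_ring n\<^esub> I) (poly_ring n)"
    by (rule R.ideal_prod_is_ideal) (rule I.ideal_axioms)+
  show ?thesis
  proof
    assume "p \<in> I \<cdot>\<^bsub>poly_ring n\<^esub> I"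
    then show "\<forall>m \<in> Poly_Mapping.keys p. \<exists>a\<in>A. \<exists>b\<in>A. \<exists>t. m = a + b + t"
    proof (induction rule: ideal_prod.induct)
      case (prod i j)
      show ?case
      proof
        fix m assume "m \<in> Poly_Mapping.keys (i \<otimes>\<^bsub>poly_ring n\<^esub> j)"
        then obtain r s where m: "m = r + s"
          and rs: "r \<in> Poly_Mapping.keys i" "s \<in> Poly_Mapping.keys j"
          using keys_mult[of i j] by (auto simp: poly_ring_def)
        have "i \<in> monomial_ideal n A" "j \<in> monomial_ideal n A"
          using prod genideal_subset_monomial_ideal[OF A] unfolding I_def by blast+
        with rs obtain a b t t' where ab: "a \<in> A" "b \<in> A" and "r = a + t" "s = b + t'"
          unfolding monomial_ideal_def by blast
        with m have "m = a + b + (t + t')" by (simp add: ac_simps)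
        with ab show "\<exists>a\<in>A. \<exists>b\<in>A. \<exists>t. m = a + b + t" by blast
      qed
    next
      case (sum p q)
      then show ?case using Poly_Mapping.keys_add[of p q] by (force simp: poly_ring_def)
    qed
  next
    assume *: "\<forall>m \<in> Poly_Mapping.keys p. \<exists>a\<in>A. \<exists>b\<in>A. \<exists>t. m = a + b + t"
    show "p \<in> I \<cdot>\<^bsub>poly_ring n\<^esub> I"
    proof (rule ideal_memI_terms[OF II])
      fix m and c :: 'k assume m: "m \<in> Poly_Mapping.keys p"
      with * obtain a b t where ab: "a \<in> A" "b \<in> A" and mt: "m = a + b + t" by blast
      have "Poly_Mapping.keys t \<subseteq> Poly_Mapping.keys m"
        by (auto simp: mt in_keys_iff lookup_add)
      then have t: "monom t c \<in> carrier (poly_ring n)"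
        using p m by (auto simp: poly_ring_def)
      have gen: "monom x (1::'k) \<in> I" if "x \<in> A" for x
        using R.genideal_self[OF gens] that unfolding I_def by blast
      have "monom t c * monom a 1 \<in> I"
        using I.I_l_closed[OF gen[OF ab(1)] t] by (simp add: poly_ring_def)
      then have "(monom t c * monom a 1) * monom b 1 \<in> I \<cdot>\<^bsub>poly_ring n\<^esub> I"
        using ideal_prod.prod[of _ I _ I "poly_ring n"] gen[OF ab(2)] by (simp add: poly_ring_def)
      then show "monom m c \<in> I \<cdot>\<^bsub>poly_ring n\<^esub> I"
        by (simp add: mult_single mt ac_simps)
    qed
  qed
qed

text \<open>If \<open>f\<close> represents an element of \<open>S/I\<^sup>2\<close> whose annihilator is the maximal ideal, then
  \<open>f \<notin> I\<^sup>2\<close>, so it has a term \<open>u\<close> outside \<open>I\<^sup>2\<close>. Multiplication by \<open>x\<^sub>i\<close> shifts exponents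
  injectively, so terms cannot cancel and \<open>x\<^sub>i u\<close> is a term of \<open>x\<^sub>i f \<in> I\<^sup>2\<close>.\<close>

lemma socle_monomial:
  fixes A :: "(nat \<Rightarrow>\<^sub>0 nat) set" and n :: nat
  defines "I \<equiv> Idl\<^bsub>poly_ring n\<^esub> ((\<lambda>a. monom a (1::'k::field)) ` A)"
  assumes A: "\<forall>a\<in>A. Poly_Mapping.keys a \<subseteq> {1..n}"
    and ass: "associated_prime (poly_ring n) (quot_module (poly_ring n) (I \<cdot>\<^bsub>poly_ring n\<^esub> I))
      (irrelevant_ideal n)"
  obtains u where "\<not> (\<exists>a\<in>A. \<exists>b\<in>A. \<exists>t. u = a + b + t)"
    and "\<And>i. i \<in> {1..n} \<Longrightarrow> \<exists>a\<in>A. \<exists>b\<in>A. \<exists>t. u + Poly_Mapping.single i 1 = a + b + t"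
proof -
  let ?R = "poly_ring n :: 'k mpoly ring"
  let ?J = "I \<cdot>\<^bsub>?R\<^esub> I"
  interpret R: cring ?R by (rule cring_poly_ring)
  have I: "ideal I ?R"
    unfolding I_def using A by (intro R.genideal_ideal) (auto simp: poly_ring_def)
  have J: "ideal ?J ?R" by (rule R.ideal_prod_is_ideal[OF I I])
  interpret P: primeideal "irrelevant_ideal n" ?R
    using ass by (simp add: associated_prime_def)
  obtain f where f: "f \<in> carrier ?R"
    and ann: "irrelevant_ideal n = {r \<in> carrier ?R. r \<otimes>\<^bsub>?R\<^esub> f \<in> ?J}"
  proof -
    obtain y where y: "y \<in> carrier (quot_module ?R ?J)"
      and P: "irrelevant_ideal n = annihilator ?R (quot_module ?R ?J) y"
      using ass by (auto simp: associated_prime_def)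
    from y obtain f where "f \<in> carrier ?R" "y = ?J +>\<^bsub>?R\<^esub> f"
      by (auto simp: quot_module_def FactRing_def A_RCOSETS_def')
    with P show ?thesis
      using that annihilator_quot_module[OF R.cring_axioms J] by blast
  qed
  \<comment> \<open>Otherwise \<open>1\<close> would annihilate the class of \<open>f\<close>, but prime ideals are proper.\<close>
  have "f \<notin> ?J"
  proof
    assume "f \<in> ?J"
    then have "\<one>\<^bsub>?R\<^esub> \<otimes>\<^bsub>?R\<^esub> f \<in> ?J" by (simp only: R.l_one[OF f])
    then have "\<one>\<^bsub>?R\<^esub> \<in> irrelevant_ideal n" unfolding ann using R.one_closed by blast
    then show False using P.one_imp_carrier P.I_notcarr by blast
  qed
  then obtain u where u: "u \<in> Poly_Mapping.keys f"
    and not_dvd: "\<not> (\<exists>a\<in>A. \<exists>b\<in>A. \<exists>t. u = a + b + t)"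
    using mem_square_iff[OF A f] unfolding I_def by blast
  have "\<exists>a\<in>A. \<exists>b\<in>A. \<exists>t. u + Poly_Mapping.single i 1 = a + b + t" if i: "i \<in> {1..n}" for i
  proof -
    have "var ` {1..n} \<subseteq> carrier ?R" by (auto simp: var_def poly_ring_def)
    from R.genideal_self[OF this] i have "var i \<in> (irrelevant_ideal n :: 'k mpoly set)"
      by (auto simp: irrelevant_ideal_def)
    then have v: "var i \<in> carrier ?R" and "var i \<otimes>\<^bsub>?R\<^esub> f \<in> ?J"
      unfolding ann by blast+
    then have J: "var i * f \<in> ?J" by (simp only: poly_ring_def monoid.simps)
    have "var i * f \<in> carrier ?R" using R.m_closed[OF v f] by (simp add: poly_ring_def)
    from mem_square_iff[OF A this] J
    have *: "\<forall>m \<in> Poly_Mapping.keys (var i * f). \<exists>a\<in>A. \<exists>b\<in>A. \<exists>t. m = a + b + t"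
      unfolding I_def by blast
    have "Poly_Mapping.single i 1 + u \<in> Poly_Mapping.keys (var i * f)"
      using u by (simp add: var_def in_keys_iff lookup_single_times)
    with * show ?thesis by (metis add.commute)
  qed
  with not_dvd that show ?thesis by blast
qed

section \<open>Squarefree exponents\<close>

definition sqfree_exp :: "nat set \<Rightarrow> nat \<Rightarrow>\<^sub>0 nat" where
  "sqfree_exp W = (\<Sum>j\<in>W. Poly_Mapping.single j 1)"

lemma lookup_sqfree_exp:
  "finite W \<Longrightarrow> Poly_Mapping.lookup (sqfree_exp W) j = of_bool (j \<in> W)"
  by (simp add: sqfree_exp_def lookup_sum lookup_single when_def)

lemma keys_sqfree_exp: "finite W \<Longrightarrow> Poly_Mapping.keys (sqfree_exp W) = W"
  by (auto simp: in_keys_iff lookup_sqfree_exp)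

lemma var_prod_eq_monom:
  "finite W \<Longrightarrow> (var_prod W :: 'k::field mpoly) = monom (sqfree_exp W) 1"
  unfolding var_prod_def sqfree_exp_def
  by (induction W rule: finite_induct) (simp_all add: var_def mult_single)

lemma exp_dvd_iff:
  fixes a m :: "nat \<Rightarrow>\<^sub>0 nat"
  shows "(\<exists>t. m = a + t) \<longleftrightarrow> (\<forall>j. Poly_Mapping.lookup a j \<le> Poly_Mapping.lookup m j)"
proof
  assume "\<forall>j. Poly_Mapping.lookup a j \<le> Poly_Mapping.lookup m j"
  then have "m = a + (m - a)"
    by (intro poly_mapping_eqI) (simp add: lookup_add lookup_minus)
  then show "\<exists>t. m = a + t" by blast
qed (auto simp: lookup_add)

text \<open>Let \<open>W\<close> be the support of \<open>u\<close>. Fix \<open>i\<close> and two generators, with supports \<open>N a\<close> and \<open>N b\<close>,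
  whose product divides \<open>x\<^sub>i u\<close> but not \<open>u\<close>. Then the exponent of \<open>x\<^sub>i\<close> in this product is one more
  than in \<open>u\<close>, and it is at most \<open>2\<close>. If \<open>i \<in> W\<close> it is therefore \<open>2\<close>, so \<open>i\<close> lies in both
  supports; if \<open>i \<notin> W\<close> it is \<open>1\<close>, so \<open>i\<close> lies in exactly one of them. The exponents of the other
  variables show that both supports are contained in \<open>W \<union> {i}\<close>. If two
  generators supported in \<open>W\<close> had disjoint supports, their product would be squarefree and divide
  \<open>u\<close>.\<close>

lemma socle_support:
  fixes N :: "'v \<Rightarrow> nat set" and V :: "'v set"
  assumes fin: "\<And>v. v \<in> V \<Longrightarrow> finite (N v)"
    and u: "\<not> (\<exists>a\<in>(\<lambda>v. sqfree_exp (N v)) ` V. \<exists>b\<in>(\<lambda>v. sqfree_exp (N v)) ` V. \<exists>t. u = a + b + t)"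
    and xu: "\<And>i. i \<in> X \<Longrightarrow> \<exists>a\<in>(\<lambda>v. sqfree_exp (N v)) ` V. \<exists>b\<in>(\<lambda>v. sqfree_exp (N v)) ` V.
      \<exists>t. u + Poly_Mapping.single i 1 = a + b + t"
    and N: "\<And>v. v \<in> V \<Longrightarrow> N v \<subseteq> X"
  obtains W where
    "\<And>a b. a \<in> V \<Longrightarrow> b \<in> V \<Longrightarrow> N a \<subseteq> W \<Longrightarrow> N b \<subseteq> W \<Longrightarrow> N a \<inter> N b \<noteq> {}"
    "\<And>i. i \<in> X \<Longrightarrow> i \<in> W \<Longrightarrow> \<exists>a\<in>V. i \<in> N a \<and> N a \<subseteq> W"
    "\<And>i. i \<in> X \<Longrightarrow> i \<notin> W \<Longrightarrow> \<exists>a\<in>V. \<exists>b\<in>V. i \<in> N a \<and> N a \<subseteq> insert i W \<and> N b \<subseteq> W"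
proof -
  define U where "U = Poly_Mapping.lookup u"
  define W where "W = {j. U j \<noteq> 0}"
  have no: "\<exists>j. U j < of_bool (j \<in> N a) + of_bool (j \<in> N b)" if "a \<in> V" "b \<in> V" for a b
    using u that fin by (auto simp: exp_dvd_iff lookup_add lookup_sqfree_exp U_def not_le)
  have yes: "\<exists>a\<in>V. \<exists>b\<in>V. i \<in> N a \<and>
      U i + 1 = of_bool (i \<in> N a) + of_bool (i \<in> N b) \<and>
      (\<forall>j. j \<noteq> i \<longrightarrow> of_bool (j \<in> N a) + of_bool (j \<in> N b) \<le> U j)" if i: "i \<in> X" for i
  proof -
    obtain a b where ab: "a \<in> V" "b \<in> V"
      and le: "\<forall>j. of_bool (j \<in> N a) + of_bool (j \<in> N b) \<le> U j + (1 when i = j)"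
      using xu[OF i] fin
      by (auto simp: exp_dvd_iff lookup_add lookup_sqfree_exp lookup_single U_def)
    have off: "\<forall>j. j \<noteq> i \<longrightarrow> of_bool (j \<in> N a) + of_bool (j \<in> N b) \<le> U j"
      using le by (metis add_0_right when_simps(2))
    with no[OF ab] have "U i < of_bool (i \<in> N a) + of_bool (i \<in> N b)"
      by (metis not_le)
    moreover have "of_bool (i \<in> N a) + of_bool (i \<in> N b) \<le> U i + 1"
      using le[rule_format, of i] by simp
    ultimately have "U i + 1 = of_bool (i \<in> N a) + of_bool (i \<in> N b)" by linarith
    moreover from this have "i \<in> N a \<or> i \<in> N b" by (auto simp: of_bool_def split: if_splits)
    ultimately show ?thesis
      using ab off by (metis (no_types, lifting) add.commute)
  qed
  show thesis
  proof (rule that[of W])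
    fix a b assume ab: "a \<in> V" "b \<in> V" "N a \<subseteq> W" "N b \<subseteq> W"
    from no[OF ab(1,2)] obtain j where j: "U j < of_bool (j \<in> N a) + of_bool (j \<in> N b)" by blast
    have "j \<in> N a \<inter> N b"
      using j ab(3,4) by (cases "j \<in> N a"; cases "j \<in> N b") (auto simp: W_def)
    then show "N a \<inter> N b \<noteq> {}" by blast
  next
    fix i assume i: "i \<in> X" "i \<in> W"
    from yes[OF i(1)] obtain a b where "a \<in> V" "i \<in> N a"
      and off: "\<forall>j. j \<noteq> i \<longrightarrow> of_bool (j \<in> N a) + of_bool (j \<in> N b) \<le> U j" by blast
    moreover have "N a \<subseteq> W"
    proof
      fix j assume "j \<in> N a"
      then show "j \<in> W" using off i(2) by (cases "j = i") (auto simp: W_def dest: spec[of _ j])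
    qed
    ultimately show "\<exists>a\<in>V. i \<in> N a \<and> N a \<subseteq> W" by blast
  next
    fix i assume i: "i \<in> X" "i \<notin> W"
    from yes[OF i(1)] obtain a b where ab: "a \<in> V" "b \<in> V" "i \<in> N a"
      and at: "U i + 1 = of_bool (i \<in> N a) + of_bool (i \<in> N b)"
      and off: "\<forall>j. j \<noteq> i \<longrightarrow> of_bool (j \<in> N a) + of_bool (j \<in> N b) \<le> U j" by blast
    have "N a \<subseteq> insert i W"
      using off by (auto simp: W_def dest: spec)
    moreover have "i \<notin> N b" using at i ab by (auto simp: W_def)
    then have "N b \<subseteq> W"
      using off by (auto simp: W_def dest: spec)
    ultimately show "\<exists>a\<in>V. \<exists>b\<in>V. i \<in> N a \<and> N a \<subseteq> insert i W \<and> N b \<subseteq> W" using ab by blast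
  qed
qed

section \<open>Distances in the graph\<close>

context pair_graph
begin

text \<open>Including the diagonal makes the \<open>k\<close>-th power of this relation describe distance at most
  \<open>k\<close> rather than walks of length exactly \<open>k\<close>.\<close>

definition closed_adj :: "'a rel" where
  "closed_adj = {(i, j). i \<in> pverts G \<and> j \<in> closed_nbhd G i}"

lemma sym_arcs: "(i, j) \<in> parcs G \<Longrightarrow> (j, i) \<in> parcs G"
  using pair_sym_arcs by (auto simp: symmetric_def elim: symE)

lemma sym_closed_adj: "sym closed_adj"
  using sym_arcs wellformed'
  by (auto simp: sym_def closed_adj_def closed_nbhd_def nbhd_def)

lemma closed_nbhd_subset: "i \<in> pverts G \<Longrightarrow> closed_nbhd G i \<subseteq> pverts G"
  using wellformed' by (auto simp: closed_nbhd_def nbhd_def)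

lemma graph_dist_le_relpow:
  assumes "(u, v) \<in> closed_adj ^^ k" and "u \<in> pverts G"
  shows "graph_dist G u v \<le> k"
proof -
  have "\<exists>p. awalk u p v \<and> length p \<le> k"
    using assms(1)
  proof (induction k arbitrary: v)
    case 0
    then show ?case using assms(2) by (auto intro!: exI[of _ "[]"] simp: awalk_Nil_iff)
  next
    case (Suc k)
    then obtain w where w: "(w, v) \<in> closed_adj" and uw: "(u, w) \<in> closed_adj ^^ k" by auto
    from Suc.IH[OF uw] obtain p where p: "awalk u p w" "length p \<le> k" by blast
    show ?case
    proof (cases "w = v")
      case True
      then show ?thesis using p by auto
    next
      case False
      then have e: "(w, v) \<in> parcs G" using w by (auto simp: closed_adj_def closed_nbhd_def nbhd_def)
      then have "awalk w [(w, v)] v"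
        using wellformed'(2)[OF e] by (simp add: awalk_Cons_iff awalk_Nil_iff)
      with p have "awalk u (p @ [(w, v)]) v" by (blast intro: awalk_appendI)
      with p(2) show ?thesis by (metis length_append_singleton Suc_le_mono)
    qed
  qed
  then obtain p where p: "awalk u p v" "length p \<le> k" by blast
  have "graph_dist G u v \<le> awalk_cost (\<lambda>_. 1) p"
    unfolding graph_dist_def by (rule min_cost_le_walk_cost[OF p(1)])
  also have "awalk_cost (\<lambda>_. 1) p = real (length p)"
    by (induction p) (auto simp: awalk_cost_def)
  also have "ereal (real (length p)) \<le> k" using p(2) by simp
  finally show ?thesis .
qed

lemma graph_diam_le:
  assumes "\<And>u v. u \<in> pverts G \<Longrightarrow> v \<in> pverts G \<Longrightarrow> graph_dist G u v \<le> k" and "pverts G \<noteq> {}"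
  shows "graph_diam G \<le> k"
proof -
  let ?D = "{graph_dist G u v | u v. u \<in> pverts G \<and> v \<in> pverts G}"
  have "?D = (\<lambda>(u, v). graph_dist G u v) ` (pverts G \<times> pverts G)" by auto
  then have "finite ?D" using pair_finite_verts by simp
  moreover have "?D \<noteq> {}" using assms(2) by auto
  ultimately show ?thesis unfolding graph_diam_def using assms(1) by (subst Max_le_iff) auto
qed

lemma connected_exists_neighbour:
  assumes "connected (with_proj G)" and "i \<in> pverts G" and "pverts G \<noteq> {i}"
  obtains j where "j \<in> nbhd G i"
proof -
  obtain k where k: "k \<in> pverts G" "k \<noteq> i" using assms(2,3) by blast
  have "i \<rightarrow>\<^sup>*\<^bsub>with_proj (mk_symmetric G)\<^esub> k"
    using assms(1,2) k(1) unfolding connected_def by (auto simp: strongly_connected_def)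
  then have "i \<rightarrow>\<^sup>*\<^bsub>with_proj G\<^esub> k" using reachable_mk_symmetric_eq[OF pair_sym_arcs] by simp
  then obtain p where p: "awalk i p k" by (auto simp: reachable_awalk)
  then obtain e p' where "p = e # p'" using k(2) by (cases p) (auto simp: awalk_Nil_iff)
  with p have "(i, snd e) \<in> parcs G" by (auto simp: awalk_Cons_iff)
  then show ?thesis using that by (simp add: nbhd_def)
qed

text \<open>With \<open>C\<close> the set of vertices whose closed neighborhood lies in \<open>W\<close>: \<open>meet\<close> bounds distances
  within \<open>C\<close> by \<open>2\<close>; \<open>inside\<close> puts every vertex of \<open>W\<close> within distance \<open>1\<close> of \<open>C\<close>; and
  \<open>outside\<close>, together with connectedness, puts every other vertex within distance \<open>1\<close> of \<open>W\<close>, hence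
  within \<open>2\<close> of \<open>C\<close>.\<close>

lemma graph_diam_le_6:
  assumes "connected (with_proj G)"
    and meet: "\<And>a b. a \<in> pverts G \<Longrightarrow> b \<in> pverts G \<Longrightarrow> closed_nbhd G a \<subseteq> W \<Longrightarrow>
      closed_nbhd G b \<subseteq> W \<Longrightarrow> closed_nbhd G a \<inter> closed_nbhd G b \<noteq> {}"
    and inside: "\<And>i. i \<in> pverts G \<Longrightarrow> i \<in> W \<Longrightarrow>
      \<exists>a\<in>pverts G. i \<in> closed_nbhd G a \<and> closed_nbhd G a \<subseteq> W"
    and outside: "\<And>i. i \<in> pverts G \<Longrightarrow> i \<notin> W \<Longrightarrow>
      \<exists>a\<in>pverts G. \<exists>b\<in>pverts G.
        i \<in> closed_nbhd G a \<and> closed_nbhd G a \<subseteq> insert i W \<and> closed_nbhd G b \<subseteq> W"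
  shows "graph_diam G \<le> 6"
proof -
  define C where "C = {c \<in> pverts G. closed_nbhd G c \<subseteq> W}"
  have self: "i \<in> closed_nbhd G i" for i by (simp add: closed_nbhd_def)
  have adj: "(a, i) \<in> closed_adj" "(i, a) \<in> closed_adj"
    if "a \<in> pverts G" "i \<in> closed_nbhd G a" for a i
  proof -
    show "(a, i) \<in> closed_adj" using that by (simp add: closed_adj_def)
    then show "(i, a) \<in> closed_adj" by (rule symD[OF sym_closed_adj])
  qed
  have near1: "\<exists>c\<in>C. (i, c) \<in> closed_adj" if "i \<in> pverts G" "i \<in> W" for i
    using inside[OF that] adj by (auto simp: C_def)
  have near: "\<exists>c\<in>C. (i, c) \<in> closed_adj O closed_adj" if i: "i \<in> pverts G" for i
  proof -
    \<comment> \<open>A vertex outside \<open>W\<close> has a closed neighbor in \<open>W\<close>: either the vertex \<open>a\<close> with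
      \<open>N[a] \<subseteq> W \<union> {i}\<close> itself, or, if \<open>a = i\<close>, any neighbor of \<open>i\<close>.\<close>
    have "\<exists>j\<in>W \<inter> pverts G. (i, j) \<in> closed_adj"
    proof (cases "i \<in> W")
      case True
      then show ?thesis using adj[OF i self] i by blast
    next
      case False
      then obtain a b where a: "a \<in> pverts G" "i \<in> closed_nbhd G a" "closed_nbhd G a \<subseteq> insert i W"
        and b: "b \<in> pverts G" "closed_nbhd G b \<subseteq> W" using outside[OF i] by blast
      show ?thesis
      proof (cases "a = i")
        case False
        then have "a \<in> W" using a(3) self[of a] by blast
        then show ?thesis using adj[OF a(1,2)] a(1) by blast
      next
        case True
        \<comment> \<open>The vertex \<open>b\<close> witnesses that \<open>i\<close> is not the only vertex, so \<open>i\<close> has a neighbor.\<close>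
        have "b \<noteq> i" using b(2) self[of b] \<open>i \<notin> W\<close> by blast
        then obtain j where j: "j \<in> nbhd G i"
          using connected_exists_neighbour[OF assms(1) i] b(1) by blast
        then have ij: "j \<in> closed_nbhd G i" by (simp add: closed_nbhd_def)
        have "j \<noteq> i" using j pair_no_loops[of "(i, j)"] by (auto simp: nbhd_def)
        then have "j \<in> W" using ij a(3) True by blast
        then show ?thesis using adj[OF i ij] closed_nbhd_subset[OF i] ij by blast
      qed
    qed
    then show ?thesis using near1 by blast
  qed
  have sym2: "(y, x) \<in> closed_adj O closed_adj" if "(x, y) \<in> closed_adj O closed_adj" for x y
    using that symD[OF sym_closed_adj] by blast
  have C2: "(c, d) \<in> closed_adj O closed_adj" if "c \<in> C" "d \<in> C" for c d
  proof -
    have c: "c \<in> pverts G" "closed_nbhd G c \<subseteq> W" and d: "d \<in> pverts G" "closed_nbhd G d \<subseteq> W"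
      using that by (simp_all add: C_def)
    then obtain j where "j \<in> closed_nbhd G c" "j \<in> closed_nbhd G d" using meet by blast
    then show ?thesis using adj(1)[OF c(1)] adj(2)[OF d(1)] by blast
  qed
  have "graph_dist G u v \<le> (6::nat)" if u: "u \<in> pverts G" and v: "v \<in> pverts G" for u v
  proof (rule graph_dist_le_relpow[OF _ u])
    obtain c d where "c \<in> C" "d \<in> C" and "(u, c) \<in> closed_adj O closed_adj"
      "(v, d) \<in> closed_adj O closed_adj" using near[OF u] near[OF v] by blast
    then have "(u, v) \<in> (closed_adj O closed_adj) O (closed_adj O closed_adj)
        O (closed_adj O closed_adj)"
      using C2 sym2 by blast
    then show "(u, v) \<in> closed_adj ^^ 6"
      by (simp add: numeral_eq_Suc O_assoc)
  qed
  moreover have "pverts G \<noteq> {}"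
    using assms(1) by (auto simp: connected_def strongly_connected_def)
  ultimately show ?thesis using graph_diam_le[of 6] by auto
qed

end

section \<open>The diameter bound\<close>

theorem corollary2p7:
  fixes n :: nat
    and G :: "nat pair_pre_digraph"
  assumes "pair_graph G"
    and "pverts G = {1..n}"
    and "Digraph_Component.connected (with_proj G)"
    and "associated_prime (poly_ring n :: 'k::field mpoly ring)
           (quot_module (poly_ring n)
             (closed_nbhd_ideal n G \<cdot>\<^bsub>poly_ring n\<^esub> closed_nbhd_ideal n G))
           (irrelevant_ideal n)"
  shows "graph_diam G \<le> 6"
proof -
  interpret pair_graph G by fact
  let ?N = "closed_nbhd G" and ?e = "\<lambda>v. sqfree_exp (closed_nbhd G v)"
  have N: "?N i \<subseteq> {1..n}" if "i \<in> {1..n}" for i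
    using closed_nbhd_subset[of i] that assms(2) by simp
  then have fin: "finite (?N i)" if "i \<in> {1..n}" for i
    using that finite_subset by blast
  have "(\<lambda>i. var_prod (?N i) :: 'k mpoly) ` {1..n} = (\<lambda>a. monom a 1) ` ?e ` {1..n}"
    unfolding image_image by (intro image_cong refl var_prod_eq_monom fin)
  then have I: "(closed_nbhd_ideal n G :: 'k mpoly set)
      = Idl\<^bsub>poly_ring n\<^esub> ((\<lambda>a. monom a 1) ` ?e ` {1..n})"
    by (simp add: closed_nbhd_ideal_def)
  have keys: "\<forall>a\<in>?e ` {1..n}. Poly_Mapping.keys a \<subseteq> {1..n}"
    using N fin by (simp add: keys_sqfree_exp)
  obtain u where
    "\<not> (\<exists>a\<in>?e ` {1..n}. \<exists>b\<in>?e ` {1..n}. \<exists>t. u = a + b + t)"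
    "\<And>i. i \<in> {1..n} \<Longrightarrow>
      \<exists>a\<in>?e ` {1..n}. \<exists>b\<in>?e ` {1..n}. \<exists>t. u + Poly_Mapping.single i 1 = a + b + t"
    using socle_monomial[OF keys assms(4)[unfolded I]] by blast
  from socle_support[where N = ?N and V = "{1..n}" and X = "{1..n}", OF fin this N]
  obtain W where
    "\<And>a b. a \<in> {1..n} \<Longrightarrow> b \<in> {1..n} \<Longrightarrow> ?N a \<subseteq> W \<Longrightarrow> ?N b \<subseteq> W \<Longrightarrow> ?N a \<inter> ?N b \<noteq> {}"
    "\<And>i. i \<in> {1..n} \<Longrightarrow> i \<in> W \<Longrightarrow> \<exists>a\<in>{1..n}. i \<in> ?N a \<and> ?N a \<subseteq> W"
    "\<And>i. i \<in> {1..n} \<Longrightarrow> i \<notin> W \<Longrightarrow>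
      \<exists>a\<in>{1..n}. \<exists>b\<in>{1..n}. i \<in> ?N a \<and> ?N a \<subseteq> insert i W \<and> ?N b \<subseteq> W"
    by blast
  then show ?thesis
    by (intro graph_diam_le_6[OF assms(3), unfolded assms(2)])
qed

end
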